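(* Consider the MAX cost. Let $G$ be an $s$–$t$ graph, $n>1$, $k\ge1$, and let $\alpha>\frac{|p_{max}|-|p_{min}|}{k}$. Suppose that for every $Q=\{p_1,\dots,p_{m'}\}\in MF$, ordered so that $|p_1|\le\dots\le|p_{m'}|$, one has $|p_1|<|p_{m'}|$; and suppose that $\alpha$ is large enough that for every such $Q$, $$\min_{\sigma\in(\Delta(Q))^n}F_n(\sigma,\alpha)<|p_1|+\frac{\mathcal{E}_{m_1,n}}{m_1}k\alpha,$$ where $m_1=m_1(Q)$ is the largest integer with $|p_1|=\dots=|p_{m_1}|$. Then $$\min_{\sigma\in(\Delta(P_{st}))^n}F_n(\sigma,\alpha)<\min_{\sigma\in\mathcal{U}_n}F_n(\sigma,\alpha).$$
   Context: Graph: $G=(V,E,s,t)$ is a finite directed acyclic multigraph ($E$ is a multiset) with source $s$ and sink $t\neq s$, such that $E\ne\emptyset$ and every edge lies on some directed $s$–$t$ path. $P_{st}$ is the set of directed $s$–$t$ paths; a path is treated as a set of edges and $|p|$ is its number of edges. $p_{max},p_{min}$ are a longest and a shortest path in $P_{st}$. Strategies: each of the $n$ agents picks a path, giving $a=(a_1,\dots,a_n)\in(P_{st})^n$; the $k$ interceptors pick $d=(d_1,\dots,d_k)\in E^k$. $\Delta X$ is the set of probability distributions on $X$; for $Q\subseteq P_{st}$, $\Delta(Q)\subseteq\Delta(P_{st})$. An element $\sigma=(\sigma_1,\dots,\sigma_n)\in(\Delta(P_{st}))^n$ is identified with the product distribution on $(P_{st})^n$. MAX cost: $C(a,d,\alpha)=\max_{i\in[n]}\left(|a_i|+\alpha\sum_{j\in[k]}\mathbf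 1\{d_j\in a_i\}\right)$. For a distribution $\sigma$ on $(P_{st})^n$, $F_n(\sigma,\alpha)=\max_{d\in E^k}\mathbb{E}_{a\sim\sigma}[C(a,d,\alpha)]$. Uniform strategies: $MF$ is the collection of inclusion-maximal sets of pairwise edge-disjoint $s$–$t$ paths (equivalently, maximal 0–1 $s$–$t$ flows with a path decomposition). For each such set, order its paths as $p_1,\dots,p_{m'}$ with $|p_1|\le\dots\le|p_{m'}|$; its prefixes are the sets $\{p_1,\dots,p_i\}$, $1\le i\le m'$. $\mathcal{U}_n$ is the set of all $U_P^n$ where $P$ is a prefix of some member of $MF$, $U_P$ is the uniform distribution on $P$, and $U_P^n$ is the product of $n$ copies of $U_P$. Notation: $\mathcal{E}_{\ell,n}=\ell\left(1-\left(1-\frac1\ell\right)^n\right)$. *)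

theory Defs
  imports "HOL-Probability.Probability" "Graph_Theory.Graph_Theory"
begin

section \<open>Graphs and paths\<close>

text \<open>Arcs are atomic objects with a tail and a head, so parallel arcs are allowed.\<close>

text \<open>A path is treated as its set of arcs; by acyclicity that set determines the path.\<close>

definition st_paths :: "('a, 'b) pre_digraph \<Rightarrow> 'a \<Rightarrow> 'a \<Rightarrow> 'b set set" where
  "st_paths G s t = {set p | p. pre_digraph.apath G s p t}"

text \<open>Nonemptiness of the arc set and the covering condition force \<open>s\<close> and \<open>t\<close> to be vertices
  and \<open>st_paths G s t\<close> to be nonempty.\<close>

locale st_graph = fin_digraph G for G :: "('a, 'b) pre_digraph" (structure) +
  fixes s t :: 'a
  assumes acyclic: "\<not> (\<exists>c. cycle c)"
    and source_neq_sink: "s \<noteq> t"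
    and arcs_nonempty: "arcs G \<noteq> {}"
    and arc_on_path: "\<And>e. e \<in> arcs G \<Longrightarrow> \<exists>p\<in>st_paths G s t. e \<in> p"

text \<open>Inclusion-maximal sets of pairwise arc-disjoint paths, and their orderings by
  nondecreasing length.\<close>

definition edge_disjoint_sets :: "('a, 'b) pre_digraph \<Rightarrow> 'a \<Rightarrow> 'a \<Rightarrow> 'b set set set" where
  "edge_disjoint_sets G s t = {Q. Q \<subseteq> st_paths G s t \<and> disjoint Q}"

definition MF :: "('a, 'b) pre_digraph \<Rightarrow> 'a \<Rightarrow> 'a \<Rightarrow> 'b set set set" where
  "MF G s t = {Q \<in> edge_disjoint_sets G s t.
                 \<forall>Q'\<in>edge_disjoint_sets G s t. Q \<subseteq> Q' \<longrightarrow> Q' = Q}"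

definition orderings :: "'b set set \<Rightarrow> 'b set list set" where
  "orderings Q = {ps. distinct ps \<and> set ps = Q \<and> sorted (map card ps)}"

text \<open>The largest number \<open>m\<close> such that the first \<open>m\<close> paths have equal length.\<close>

definition num_shortest :: "'b set list \<Rightarrow> nat" where
  "num_shortest ps = (GREATEST m. m \<le> length ps \<and> (\<forall>i<m. card (ps ! i) = card (ps ! 0)))"

section \<open>Strategies and cost\<close>

text \<open>Agents are numbered by \<open>{..<n}\<close> and interceptors by \<open>{..<k}\<close>; a pure profile of the agents
  is a function \<open>a\<close> of which only the values on \<open>{..<n}\<close> matter, and likewise for the interceptors.\<close>

definition max_cost :: "nat \<Rightarrow> nat \<Rightarrow> (nat \<Rightarrow> 'b set) \<Rightarrow> (nat \<Rightarrow> 'b) \<Rightarrow> real \<Rightarrow> real" where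
  "max_cost n k a d \<alpha> =
     (MAX i\<in>{..<n}. real (card (a i)) + \<alpha> * (\<Sum>j<k. of_bool (d j \<in> a i)))"

definition worst_cost ::
  "('a, 'b) pre_digraph \<Rightarrow> nat \<Rightarrow> nat \<Rightarrow> (nat \<Rightarrow> 'b set) pmf \<Rightarrow> real \<Rightarrow> real" where
  "worst_cost G n k \<sigma> \<alpha> =
     (MAX d\<in>{..<k} \<rightarrow>\<^sub>E arcs G. measure_pmf.expectation \<sigma> (\<lambda>a. max_cost n k a d \<alpha>))"

definition mixed :: "'b set set \<Rightarrow> 'b set pmf set" where
  "mixed Q = {\<mu>. set_pmf \<mu> \<subseteq> Q}"

definition product_dist :: "nat \<Rightarrow> (nat \<Rightarrow> 'b set pmf) \<Rightarrow> (nat \<Rightarrow> 'b set) pmf" where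
  "product_dist n \<sigma> = Pi_pmf {..<n} undefined \<sigma>"

text \<open>The minimum of \<open>worst_cost\<close> over \<open>({..<n} \<rightarrow>\<^sub>E mixed Q)\<close>, written as an infimum;
  it is attained, see \<open>min_worst_cost_attained\<close> below.\<close>

definition min_worst_cost ::
  "('a, 'b) pre_digraph \<Rightarrow> nat \<Rightarrow> nat \<Rightarrow> 'b set set \<Rightarrow> real \<Rightarrow> real" where
  "min_worst_cost G n k Q \<alpha> =
     (INF \<sigma>\<in>{..<n} \<rightarrow>\<^sub>E mixed Q. worst_cost G n k (product_dist n \<sigma>) \<alpha>)"

text \<open>If several paths have the same length, the prefixes of all admissible orderings are taken.\<close>

definition prefixes_MF :: "('a, 'b) pre_digraph \<Rightarrow> 'a \<Rightarrow> 'a \<Rightarrow> 'b set set set" where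
  "prefixes_MF G s t =
     {set (take i ps) | i ps Q. Q \<in> MF G s t \<and> ps \<in> orderings Q \<and> 1 \<le> i \<and> i \<le> length ps}"

definition uniform_strategies ::
  "('a, 'b) pre_digraph \<Rightarrow> 'a \<Rightarrow> 'a \<Rightarrow> nat \<Rightarrow> (nat \<Rightarrow> 'b set) pmf set" where
  "uniform_strategies G s t n =
     (\<lambda>P. product_dist n (\<lambda>_. pmf_of_set P)) ` prefixes_MF G s t"

definition hit_factor :: "nat \<Rightarrow> nat \<Rightarrow> real" where
  "hit_factor l n = real l * (1 - (1 - 1 / real l) ^ n)"

section \<open>Existence of the minima\<close>

lemma continuous_on_MAX:
  fixes f :: "'i \<Rightarrow> 'c::topological_space \<Rightarrow> real"
  assumes "finite D" "D \<noteq> {}" "\<And>d. d \<in> D \<Longrightarrow> continuous_on S (f d)"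
  shows "continuous_on S (\<lambda>x. MAX d\<in>D. f d x)"
  using assms
proof (induction D rule: finite_ne_induct)
  case (insert d D)
  have "(\<lambda>x. MAX d\<in>insert d D. f d x) = (\<lambda>x. max (f d x) (MAX d\<in>D. f d x))"
    using insert.hyps by (auto simp: Max_insert)
  then show ?case using insert by (auto intro!: continuous_on_max)
qed auto

lemma min_worst_cost_attained:
  fixes G :: "('a, 'b) pre_digraph"
  assumes G: "finite (arcs G)" "arcs G \<noteq> {}" and Q: "finite Q" "Q \<noteq> {}"
  shows "\<exists>\<sigma>\<in>{..<n} \<rightarrow>\<^sub>E mixed Q.
           worst_cost G n k (product_dist n \<sigma>) \<alpha> = min_worst_cost G n k Q \<alpha> \<and>
           (\<forall>\<tau>\<in>{..<n} \<rightarrow>\<^sub>E mixed Q.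
              worst_cost G n k (product_dist n \<sigma>) \<alpha> \<le> worst_cost G n k (product_dist n \<tau>) \<alpha>)"
proof -
  let ?S = "{..<n} \<rightarrow>\<^sub>E mixed Q"
  define F where "F \<sigma> = worst_cost G n k (product_dist n \<sigma>) \<alpha>" for \<sigma> :: "nat \<Rightarrow> 'b set pmf"
  define D where "D = ({..<k} \<rightarrow>\<^sub>E arcs G)"
  have D: "finite D" "D \<noteq> {}"
    unfolding D_def using G by (auto intro!: finite_PiE simp: PiE_eq_empty_iff)
  define A where "A = ({..<n} \<rightarrow>\<^sub>E Q)"
  have A: "finite A" unfolding A_def using Q by (auto intro!: finite_PiE)
  define H :: "(nat \<times> 'b set \<Rightarrow> real) \<Rightarrow> real" where
    "H x = (MAX d\<in>D. \<Sum>a\<in>A. (\<Prod>i<n. x (i, a i)) * max_cost n k a d \<alpha>)" for x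
  define V :: "nat \<times> 'b set \<Rightarrow> real set" where
    "V z = (if z \<in> {..<n} \<times> Q then {0..1} else {0})" for z
  define K where "K = (PiE UNIV V) \<inter> {x. \<forall>i<n. (\<Sum>q\<in>Q. x (i, q)) = 1}"
  have "compact (PiE UNIV V)"
  proof -
    have "compactin (product_topology (\<lambda>_. euclidean) UNIV) (PiE UNIV V)"
      unfolding compactin_PiE by (auto simp: V_def)
    then show ?thesis by (simp add: euclidean_product_topology)
  qed
  moreover have "closed {x :: nat \<times> 'b set \<Rightarrow> real. \<forall>i<n. (\<Sum>q\<in>Q. x (i, q)) = 1}"
    by (intro closed_Collect_all closed_Collect_imp closed_Collect_eq continuous_on_sum
          continuous_on_product_coordinates) auto
  ultimately have K: "compact K" unfolding K_def by (rule compact_Int_closed)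
  have H: "continuous_on K H"
    unfolding H_def
    by (intro continuous_on_MAX D continuous_on_sum continuous_on_mult continuous_on_prod
          continuous_on_const continuous_on_subset[OF continuous_on_product_coordinates]) auto
  have FH: "F \<sigma> = H x"
    if \<sigma>: "\<And>i. i < n \<Longrightarrow> set_pmf (\<sigma> i) \<subseteq> Q" and x: "\<And>i q. i < n \<Longrightarrow> x (i, q) = pmf (\<sigma> i) q"
    for \<sigma> x
  proof -
    have supp: "a \<in> A" if "a \<in> set_pmf (product_dist n \<sigma>)" for a
      using that \<sigma> unfolding product_dist_def A_def
      by (force simp: set_Pi_pmf PiE_dflt_def PiE_def extensional_def)
    have "measure_pmf.expectation (product_dist n \<sigma>) (\<lambda>a. max_cost n k a d \<alpha>)
        = (\<Sum>a\<in>A. (\<Prod>i<n. x (i, a i)) * max_cost n k a d \<alpha>)" for d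
    proof -
      have "measure_pmf.expectation (product_dist n \<sigma>) (\<lambda>a. max_cost n k a d \<alpha>)
          = (\<Sum>a\<in>A. max_cost n k a d \<alpha> * pmf (product_dist n \<sigma>) a)"
        using A supp by (intro integral_measure_pmf_real) auto
      also have "\<dots> = (\<Sum>a\<in>A. (\<Prod>i<n. x (i, a i)) * max_cost n k a d \<alpha>)"
      proof (rule sum.cong)
        fix a assume "a \<in> A"
        then have "pmf (product_dist n \<sigma>) a = (\<Prod>i<n. pmf (\<sigma> i) (a i))"
          unfolding product_dist_def A_def by (intro pmf_Pi') (auto simp: PiE_def extensional_def)
        then show "max_cost n k a d \<alpha> * pmf (product_dist n \<sigma>) a =
            (\<Prod>i<n. x (i, a i)) * max_cost n k a d \<alpha>"
          by (simp add: x)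
      qed simp
      finally show ?thesis .
    qed
    then show ?thesis unfolding F_def H_def worst_cost_def D_def by simp
  qed
  define enc where "enc \<sigma> = (\<lambda>(i, q). if i < n then pmf (\<sigma> i) q else 0)"
    for \<sigma> :: "nat \<Rightarrow> 'b set pmf"
  have encK: "enc \<sigma> \<in> K" and encF: "F \<sigma> = H (enc \<sigma>)" if "\<sigma> \<in> ?S" for \<sigma>
  proof -
    have sub: "set_pmf (\<sigma> i) \<subseteq> Q" if "i < n" for i
      using that \<open>\<sigma> \<in> ?S\<close> by (auto simp: mixed_def PiE_def Pi_def)
    then have "pmf (\<sigma> i) q = 0" if "i < n" "q \<notin> Q" for i q
      using sub[OF that(1)] that(2) pmf_eq_0_set_pmf by fastforce
    moreover have "(\<Sum>q\<in>Q. pmf (\<sigma> i) q) = 1" if "i < n" for i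
      using sub[OF that] Q by (intro sum_pmf_eq_1) auto
    ultimately show "enc \<sigma> \<in> K"
      by (auto simp: K_def V_def enc_def pmf_le_1)
    show "F \<sigma> = H (enc \<sigma>)" using sub by (intro FH) (auto simp: enc_def)
  qed
  have S_ne: "?S \<noteq> {}"
  proof -
    obtain q where "q \<in> Q" using Q by auto
    then have "return_pmf q \<in> mixed Q" by (simp add: mixed_def)
    then show ?thesis by (auto simp: PiE_eq_empty_iff)
  qed
  then have "K \<noteq> {}" using encK by auto
  then obtain x where x: "x \<in> K" "\<And>y. y \<in> K \<Longrightarrow> H x \<le> H y"
    using continuous_attains_inf[OF K _ H] by auto
  have xV: "x z \<in> V z" for z using x(1) by (auto simp: K_def)
  have x0: "0 \<le> x z" for z using xV[of z] by (auto simp: V_def split: if_splits)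
  have xQ: "x (i, q) = 0" if "q \<notin> Q" for i q using xV[of "(i, q)"] that by (auto simp: V_def)
  define \<sigma> where "\<sigma> = restrict (\<lambda>i. embed_pmf (\<lambda>q. x (i, q))) {..<n}"
  have pmf\<sigma>: "pmf (\<sigma> i) q = x (i, q)" if "i < n" for i q
  proof -
    have "(\<integral>\<^sup>+q. ennreal (x (i, q)) \<partial>count_space UNIV) = (\<integral>\<^sup>+q. ennreal (x (i, q)) \<partial>count_space Q)"
      using xQ by (intro nn_integral_count_space_eq) auto
    also have "\<dots> = ennreal (\<Sum>q\<in>Q. x (i, q))"
      using Q x0 by (simp add: nn_integral_count_space_finite sum_ennreal)
    also have "\<dots> = 1" using x(1) that by (simp add: K_def)
    finally show ?thesis using that x0 by (simp add: \<sigma>_def pmf_embed_pmf)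
  qed
  have sub: "set_pmf (\<sigma> i) \<subseteq> Q" if "i < n" for i
  proof
    fix q assume "q \<in> set_pmf (\<sigma> i)"
    then have "x (i, q) \<noteq> 0" by (simp add: set_pmf_iff pmf\<sigma>[OF that])
    then show "q \<in> Q" using xQ by blast
  qed
  then have \<sigma>: "\<sigma> \<in> ?S" by (auto simp: \<sigma>_def mixed_def)
  have "F \<sigma> = H x" using sub by (intro FH) (auto simp: pmf\<sigma>)
  then have le: "F \<sigma> \<le> F \<tau>" if "\<tau> \<in> ?S" for \<tau> using x(2) encK encF that by simp
  have "(INF \<tau>\<in>?S. F \<tau>) = F \<sigma>"
    using \<sigma> le by (intro cInf_eq_minimum) auto
  then show ?thesis using \<sigma> le unfolding min_worst_cost_def F_def by auto
qed

context st_graph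
begin

lemma finite_st_paths: "finite (st_paths G s t)"
  by (rule finite_subset[of _ "Pow (arcs G)"]) (auto simp: st_paths_def apath_def awalk_def)

lemma st_paths_nonempty: "st_paths G s t \<noteq> {}"
  using arcs_nonempty arc_on_path by blast

lemma MF_finite: "Q \<in> MF G s t \<Longrightarrow> finite Q"
  using finite_st_paths by (auto simp: MF_def edge_disjoint_sets_def intro: finite_subset)

lemma MF_member_nonempty:
  assumes "Q \<in> MF G s t" shows "Q \<noteq> {}"
proof
  assume "Q = {}"
  obtain p where "p \<in> st_paths G s t" using st_paths_nonempty by blast
  then have "{p} \<in> edge_disjoint_sets G s t" by (simp add: edge_disjoint_sets_def)
  then show False using assms \<open>Q = {}\<close> by (auto simp: MF_def)
qed

lemma MF_nonempty: "MF G s t \<noteq> {}"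
proof -
  have "finite (edge_disjoint_sets G s t)"
    by (rule finite_subset[of _ "Pow (st_paths G s t)"])
       (auto simp: edge_disjoint_sets_def finite_st_paths)
  moreover have "{} \<in> edge_disjoint_sets G s t" by (simp add: edge_disjoint_sets_def)
  ultimately obtain Q where "Q \<in> edge_disjoint_sets G s t"
    "\<forall>Q'\<in>edge_disjoint_sets G s t. Q \<le> Q' \<longrightarrow> Q = Q'"
    using finite_has_maximal[of "edge_disjoint_sets G s t"] by blast
  then show ?thesis by (auto simp: MF_def)
qed

lemma orderings_nonempty:
  assumes "finite Q" shows "orderings Q \<noteq> {}"
proof -
  obtain ps where "set ps = Q" "distinct ps" using finite_distinct_list[OF assms] by blast
  then have "sort_key card ps \<in> orderings Q" by (simp add: orderings_def)
  then show ?thesis by blast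
qed

lemma finite_uniform_strategies: "finite (uniform_strategies G s t n)"
proof -
  have "prefixes_MF G s t \<subseteq> Pow (st_paths G s t)"
    using set_take_subset
    by (fastforce simp: prefixes_MF_def MF_def edge_disjoint_sets_def orderings_def)
  then show ?thesis
    unfolding uniform_strategies_def using finite_st_paths finite_subset by blast
qed

lemma uniform_strategies_nonempty: "uniform_strategies G s t n \<noteq> {}"
proof -
  obtain Q where Q: "Q \<in> MF G s t" using MF_nonempty by blast
  then obtain ps where ps: "ps \<in> orderings Q" using orderings_nonempty MF_finite by blast
  then have "ps \<noteq> []" using MF_member_nonempty[OF Q] by (auto simp: orderings_def)
  then have "1 \<le> length ps" by (cases ps) auto
  then have "set (take 1 ps) \<in> prefixes_MF G s t" using Q ps by (auto simp: prefixes_MF_def)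
  then show ?thesis by (auto simp: uniform_strategies_def)
qed

end

end

theory Submission
  imports Defs
begin

text \<open>Take a prefix \<open>P\<close> of a maximal disjoint set \<open>Q\<close>. If all paths of \<open>P\<close> have the same
  length, concentrating all interceptors on one of them costs at least
  \<open>|p\<^sub>1| + (\<E>\<^bsub>m\<^sub>1,n\<^esub> / m\<^sub>1) k \<alpha>\<close>, which exceeds the minimum over \<open>(\<Delta>(Q))\<^sup>n\<close>
  by hypothesis. Otherwise some path of \<open>P\<close> is longer than \<open>p\<^sub>1\<close>, and a single agent improves the
  uniform profile by moving a little probability to \<open>p\<^sub>1\<close>. Indeed an interception touching \<open>p\<^sub>1\<close>
  is not a best response: moving its interceptors from \<open>p\<^sub>1\<close> to the longer path spreads the two
  path costs apart, and the expected maximum of independent uniform picks is strictly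
  Schur-convex in the path costs. Against every other interception, \<open>p\<^sub>1\<close> is the cheapest path of
  \<open>P\<close>, strictly cheaper than the longer path.\<close>

section \<open>Expected maxima of independent uniform picks\<close>

text \<open>Exchanging \<open>u\<close> and \<open>v\<close> permutes the profiles, so each sum is
  half the sum of the symmetrised terms \<open>M f a + M (\<lambda>p. f (\<tau> p)) a\<close>. For
  these the comparison holds profile by profile, although it can fail for \<open>M\<close> alone: a
  profile with all picks equal to \<open>u\<close> gets cheaper.\<close>

lemma sum_Max_spread:
  fixes w w' :: "'c \<Rightarrow> real" and n :: nat
  assumes P: "finite P" "u \<in> P" "v \<in> P" "u \<noteq> v" and n: "n > 1"
    and same: "\<And>p. p \<in> P \<Longrightarrow> p \<noteq> u \<Longrightarrow> p \<noteq> v \<Longrightarrow> w' p = w p"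
    and total: "w' u + w' v = w u + w v" and below: "w' u < w u" "w' u < w v"
  shows "(\<Sum>a\<in>{..<n} \<rightarrow>\<^sub>E P. MAX i\<in>{..<n}. w (a i)) < (\<Sum>a\<in>{..<n} \<rightarrow>\<^sub>E P. MAX i\<in>{..<n}. w' (a i))"
proof -
  let ?A = "{..<n} \<rightarrow>\<^sub>E P"
  define \<tau> where "\<tau> = Transposition.transpose u v"
  have \<tau>: "\<tau> u = v" "\<tau> v = u" "\<And>p. p \<noteq> u \<Longrightarrow> p \<noteq> v \<Longrightarrow> \<tau> p = p" "\<And>p. \<tau> (\<tau> p) = p"
    by (auto simp: \<tau>_def)
  then have \<tau>P: "\<tau> p \<in> P" if "p \<in> P" for p
    using P that by metis
  define M where "M f a = (MAX i\<in>{..<n}. f (a i))" for f :: "'c \<Rightarrow> real" and a :: "nat \<Rightarrow> 'c"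
  have M_ge: "f (a i) \<le> M f a" if "i < n" for f a i
    unfolding M_def using that by (intro Max_ge) auto
  have M_ex: "\<exists>i<n. M f a = f (a i)" for f a
  proof -
    have "M f a \<in> (\<lambda>i. f (a i)) ` {..<n}"
      unfolding M_def using n by (intro Max_in) (auto simp: lessThan_empty_iff)
    then show ?thesis by auto
  qed
  have twice: "2 * (\<Sum>a\<in>?A. M f a) = (\<Sum>a\<in>?A. M f a + M (\<lambda>p. f (\<tau> p)) a)" for f
  proof -
    have "(\<Sum>a\<in>?A. M f a) = (\<Sum>a\<in>?A. M (\<lambda>p. f (\<tau> p)) a)"
      by (rule sum.reindex_bij_witness[of _ "\<lambda>a. \<lambda>i\<in>{..<n}. \<tau> (a i)" "\<lambda>a. \<lambda>i\<in>{..<n}. \<tau> (a i)"])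
         (auto simp: \<tau> \<tau>P M_def PiE_def Pi_iff extensional_def fun_eq_iff)
    then show ?thesis by (simp add: sum.distrib)
  qed
  have up: "w u < w' v" "w v < w' v" using total below by auto
  \<comment> \<open>The positions \<open>i\<close> and \<open>j\<close> attaining the left-hand
    maxima bound both right-hand maxima from below. If \<open>a i\<close> and \<open>a j\<close> are
    the same element of \<open>{u, v}\<close>, the equal totals settle the case; otherwise
    \<open>same\<close> and \<open>up\<close> bound the two left-hand maxima by distinct right-hand
    ones.\<close>
  have le: "M w a + M (\<lambda>p. w (\<tau> p)) a \<le> M w' a + M (\<lambda>p. w' (\<tau> p)) a" if a: "a \<in> ?A" for a
  proof -
    obtain i where i: "i < n" "M w a = w (a i)" using M_ex by blast
    obtain j where j: "j < n" "M (\<lambda>p. w (\<tau> p)) a = w (\<tau> (a j))" using M_ex by metis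
    have *: "a i \<in> P" "a j \<in> P" using a i j by auto
    have ge: "w' (a i) \<le> M w' a" "w' (a j) \<le> M w' a"
      "w' (\<tau> (a i)) \<le> M (\<lambda>p. w' (\<tau> p)) a" "w' (\<tau> (a j)) \<le> M (\<lambda>p. w' (\<tau> p)) a"
      using M_ge[OF i(1)] M_ge[OF j(1)] M_ge[where f="\<lambda>p. w' (\<tau> p)", OF i(1)]
        M_ge[where f="\<lambda>p. w' (\<tau> p)", OF j(1)] by auto
    show ?thesis
      using i j ge same[OF *(1)] same[OF *(2)] up total below \<tau> P(4)
      by (cases "a i = u"; cases "a i = v"; cases "a j = u"; cases "a j = v") auto
  qed
  \<comment> \<open>A profile with both \<open>u\<close> and \<open>v\<close>, available since
    \<open>n > 1\<close>. Both spread maxima reach \<open>w' v\<close>, which exceeds the old costs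
    of \<open>u\<close> and \<open>v\<close>.\<close>
  define b where "b = (\<lambda>i\<in>{..<n}. if i = 0 then u else v)"
  have b: "b \<in> ?A" using P by (auto simp: b_def)
  have b01: "b 0 = u" "b 1 = v" using n by (auto simp: b_def)
  have less: "M w b + M (\<lambda>p. w (\<tau> p)) b < M w' b + M (\<lambda>p. w' (\<tau> p)) b"
  proof -
    have "M w' b \<ge> w' v" using M_ge[of 1 w' b] n b01 by auto
    moreover have "M (\<lambda>p. w' (\<tau> p)) b \<ge> w' v"
      using M_ge[of 0 "\<lambda>p. w' (\<tau> p)" b] n b01 \<tau> by auto
    moreover have "M w b < w' v"
      using M_ex[of w b] up by (auto simp: b_def split: if_splits)
    moreover have "M (\<lambda>p. w (\<tau> p)) b < w' v"
      using M_ex[of "\<lambda>p. w (\<tau> p)" b] up \<tau> by (auto simp: b_def split: if_splits)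
    ultimately show ?thesis by linarith
  qed
  have "finite ?A" using P by (auto intro!: finite_PiE)
  then have "(\<Sum>a\<in>?A. M w a + M (\<lambda>p. w (\<tau> p)) a) < (\<Sum>a\<in>?A. M w' a + M (\<lambda>p. w' (\<tau> p)) a)"
    using le less b by (intro sum_strict_mono_ex1) auto
  then have "2 * (\<Sum>a\<in>?A. M w a) < 2 * (\<Sum>a\<in>?A. M w' a)" unfolding twice .
  then show ?thesis by (simp add: M_def)
qed

section \<open>Small mixture weights and expectations under product distributions\<close>

text \<open>To be used with \<open>A d\<close> the present cost against \<open>d\<close> and
  \<open>B d\<close> the cost after a deviation. Where \<open>A\<close> attains \<open>F\<close>,
  any positive weight on \<open>B\<close> helps; elsewhere the slack at weight 0 persists for small
  weights by continuity. Finitely many \<open>d\<close> share a common weight.\<close>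

lemma mixture_below_Max:
  fixes A B :: "'d \<Rightarrow> real"
  assumes D: "finite D" "D \<noteq> {}"
    and A: "\<And>d. d \<in> D \<Longrightarrow> A d \<le> F" and B: "\<And>d. d \<in> D \<Longrightarrow> A d = F \<Longrightarrow> B d < F"
  shows "\<exists>\<epsilon>. 0 < \<epsilon> \<and> \<epsilon> < 1 \<and> (\<forall>d\<in>D. \<epsilon> * B d + (1 - \<epsilon>) * A d < F)"
proof -
  have pos: "eventually (\<lambda>\<epsilon>::real. 0 < \<epsilon> \<and> \<epsilon> < 1) (at_right 0)"
    by (auto simp: eventually_at_right_field intro: exI[of _ 1])
  have "eventually (\<lambda>\<epsilon>. \<epsilon> * B d + (1 - \<epsilon>) * A d < F) (at_right 0)" if d: "d \<in> D" for d
  proof (cases "A d = F")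
    case True
    show ?thesis using pos
    proof eventually_elim
      case (elim \<epsilon>)
      then have "\<epsilon> * B d < \<epsilon> * F" using B[OF d True] by simp
      then show ?case using True by (simp add: algebra_simps)
    qed
  next
    case False
    have "((\<lambda>\<epsilon>. \<epsilon> * B d + (1 - \<epsilon>) * A d) \<longlongrightarrow> 0 * B d + (1 - 0) * A d) (at_right 0)"
      by (intro tendsto_intros)
    then show ?thesis using A[OF d] False by (intro order_tendstoD(2)) auto
  qed
  then have "eventually (\<lambda>\<epsilon>. \<forall>d\<in>D. \<epsilon> * B d + (1 - \<epsilon>) * A d < F) (at_right 0)"
    using D by (intro eventually_ball_finite) auto
  with pos have "eventually (\<lambda>\<epsilon>. 0 < \<epsilon> \<and> \<epsilon> < 1 \<and> (\<forall>d\<in>D. \<epsilon> * B d + (1 - \<epsilon>) * A d < F)) (at_right 0)"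
    by eventually_elim auto
  then show ?thesis by (rule eventually_happens'[OF trivial_limit_at_right_real])
qed

lemma product_dist_uniform:
  assumes "finite P" "P \<noteq> {}"
  shows "product_dist n (\<lambda>_. pmf_of_set P) = pmf_of_set ({..<n} \<rightarrow>\<^sub>E P)"
proof -
  have "PiE_dflt {..<n} undefined (\<lambda>_. P) = {..<n} \<rightarrow>\<^sub>E P"
    by (auto simp: PiE_dflt_def PiE_def extensional_def)
  then show ?thesis
    unfolding product_dist_def using assms by (subst Pi_pmf_of_set) auto
qed

lemma expectation_product_dist_uniform:
  fixes h :: "(nat \<Rightarrow> 'b set) \<Rightarrow> real"
  assumes "finite P" "P \<noteq> {}"
  shows "measure_pmf.expectation (product_dist n (\<lambda>_. pmf_of_set P)) h =
    (\<Sum>a\<in>{..<n} \<rightarrow>\<^sub>E P. h a) / real (card P) ^ n"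
  unfolding product_dist_uniform[OF assms] using assms
  by (subst integral_pmf_of_set) (auto intro!: finite_PiE simp: PiE_eq_empty_iff card_PiE)

text \<open>Condition on the coin of agent 0: on success its pick is overwritten by
  \<open>q\<close>, on failure the whole profile is distributed as before.\<close>

lemma expectation_product_dist_mixture:
  fixes h :: "(nat \<Rightarrow> 'b set) \<Rightarrow> real" and q :: "'b set"
  assumes \<epsilon>: "0 \<le> \<epsilon>" "\<epsilon> \<le> 1" and n: "n > 0" and \<mu>: "finite (set_pmf \<mu>)"
  defines "\<nu> \<equiv> bernoulli_pmf \<epsilon> \<bind> (\<lambda>b. if b then return_pmf q else \<mu>)"
  shows "measure_pmf.expectation (product_dist n ((\<lambda>_. \<mu>)(0 := \<nu>))) h =
    \<epsilon> * measure_pmf.expectation (product_dist n (\<lambda>_. \<mu>)) (\<lambda>a. h (a(0 := q)))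
    + (1 - \<epsilon>) * measure_pmf.expectation (product_dist n (\<lambda>_. \<mu>)) h"
proof -
  let ?U = "product_dist n (\<lambda>_. \<mu>)"
  define R where "R = Pi_pmf {1..<n} (undefined :: 'b set) (\<lambda>_. \<mu>)"
  have split: "{..<n} = insert 0 {1..<n}" using n by auto
  have dist: "product_dist n ((\<lambda>_. \<mu>)(0 := \<rho>)) = \<rho> \<bind> (\<lambda>y. R \<bind> (\<lambda>f. return_pmf (f(0 := y))))" for \<rho>
  proof -
    have "Pi_pmf {1..<n} undefined ((\<lambda>_. \<mu>)(0 := \<rho>)) = R"
      unfolding R_def by (intro Pi_pmf_cong) auto
    then show ?thesis unfolding product_dist_def split by (subst Pi_pmf_insert') auto
  qed
  have U: "?U = \<mu> \<bind> (\<lambda>y. R \<bind> (\<lambda>f. return_pmf (f(0 := y))))"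
  proof -
    have "(\<lambda>_::nat. \<mu>)(0 := \<mu>) = (\<lambda>_. \<mu>)" by auto
    then show ?thesis using dist[of \<mu>] by (simp only:)
  qed
  have finU: "finite (set_pmf ?U)"
    unfolding product_dist_def by (subst set_Pi_pmf) (auto intro!: finite_PiE_dflt \<mu>)
  \<comment> \<open>Overwriting agent 0's pick discards its own draw, so only the picks
    \<open>R\<close> of the other agents remain random.\<close>
  have upd: "map_pmf (\<lambda>a. a(0 := q)) ?U = R \<bind> (\<lambda>f. return_pmf (f(0 := q)))"
    unfolding U by (simp add: map_bind_pmf)
  have "product_dist n ((\<lambda>_. \<mu>)(0 := \<nu>)) =
      bernoulli_pmf \<epsilon> \<bind> (\<lambda>b. if b then map_pmf (\<lambda>a. a(0 := q)) ?U else ?U)"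
    unfolding dist \<nu>_def bind_assoc_pmf upd
    by (intro bind_pmf_cong refl) (auto simp: bind_return_pmf U)
  also have "measure_pmf.expectation \<dots> h =
      \<epsilon> * measure_pmf.expectation (map_pmf (\<lambda>a. a(0 := q)) ?U) h
      + (1 - \<epsilon>) * measure_pmf.expectation ?U h"
    using \<epsilon> finU by (subst pmf_expectation_bind[of UNIV]) (auto simp: UNIV_bool)
  finally show ?thesis by (simp only: integral_map_pmf)
qed

section \<open>Costs of single paths and of profiles\<close>

text \<open>For a fixed interception, the cost of a profile is the maximum of this one function over
  the picks, the form that \<open>sum_Max_spread\<close> compares.\<close>

definition path_cost :: "nat \<Rightarrow> (nat \<Rightarrow> 'b) \<Rightarrow> real \<Rightarrow> 'b set \<Rightarrow> real" where
  "path_cost k d \<alpha> p = real (card p) + \<alpha> * (\<Sum>j<k. of_bool (d j \<in> p))"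

lemma max_cost_eq: "max_cost n k a d \<alpha> = (MAX i\<in>{..<n}. path_cost k d \<alpha> (a i))"
  by (simp add: max_cost_def path_cost_def)

lemma path_cost_le_max_cost: "i < n \<Longrightarrow> path_cost k d \<alpha> (a i) \<le> max_cost n k a d \<alpha>"
  unfolding max_cost_eq by (intro Max_ge) auto

lemma max_cost_leI:
  assumes "n > 0" "\<And>i. i < n \<Longrightarrow> path_cost k d \<alpha> (a i) \<le> c"
  shows "max_cost n k a d \<alpha> \<le> c"
  unfolding max_cost_eq using assms by (subst Max_le_iff) (auto simp: lessThan_empty_iff)

lemma max_cost_cheapest_deviation:
  assumes n: "n > 0" and a: "a \<in> {..<n} \<rightarrow> P"
    and cheap: "\<And>p. p \<in> P \<Longrightarrow> path_cost k d \<alpha> u \<le> path_cost k d \<alpha> p"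
  shows "max_cost n k (a(0 := u)) d \<alpha> \<le> max_cost n k a d \<alpha>"
proof (rule max_cost_leI[OF n])
  fix i assume "i < n"
  then have "path_cost k d \<alpha> ((a(0 := u)) i) \<le> path_cost k d \<alpha> (a i)"
    using cheap a by auto
  also have "\<dots> \<le> max_cost n k a d \<alpha>" using \<open>i < n\<close> by (rule path_cost_le_max_cost)
  finally show "path_cost k d \<alpha> ((a(0 := u)) i) \<le> max_cost n k a d \<alpha>" .
qed

lemma finite_interceptions:
  fixes k :: nat
  assumes "finite (arcs G)" "arcs G \<noteq> {}"
  shows "finite ({..<k} \<rightarrow>\<^sub>E arcs G)" "{..<k} \<rightarrow>\<^sub>E arcs G \<noteq> {}"
  using assms by (auto intro!: finite_PiE simp: PiE_eq_empty_iff)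

lemma expectation_le_worst_cost:
  assumes "finite (arcs G)" "d \<in> {..<k} \<rightarrow>\<^sub>E arcs G"
  shows "measure_pmf.expectation \<sigma> (\<lambda>a. max_cost n k a d \<alpha>) \<le> worst_cost G n k \<sigma> \<alpha>"
  unfolding worst_cost_def using assms by (intro Max_ge) (auto intro!: finite_PiE)

section \<open>The uniform profile on disjoint paths\<close>

context
  fixes G :: "('a, 'b) pre_digraph" and P :: "'b set set" and n k :: nat and \<alpha> :: real
  assumes G: "finite (arcs G)" "arcs G \<noteq> {}"
    and P: "finite P" "\<Union>P \<subseteq> arcs G" "disjoint P" and n: "n > 1" and \<alpha>: "\<alpha> > 0"
begin

private abbreviation uniform_cost :: "(nat \<Rightarrow> 'b) \<Rightarrow> real" where
  "uniform_cost d \<equiv>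
     measure_pmf.expectation (product_dist n (\<lambda>_. pmf_of_set P)) (\<lambda>a. max_cost n k a d \<alpha>)"

text \<open>Interceptors on \<open>u\<close> do more harm on the longer \<open>v\<close>: shifting
  them there drives the costs of the two paths apart, and \<open>sum_Max_spread\<close> applies.
  Hence no best response touches \<open>u\<close>.\<close>

lemma shorter_path_not_intercepted:
  assumes u: "u \<in> P" and v: "v \<in> P" and uv: "card u < card v"
    and d: "d \<in> {..<k} \<rightarrow>\<^sub>E arcs G" and j: "j < k" "d j \<in> u"
  shows "uniform_cost d < worst_cost G n k (product_dist n (\<lambda>_. pmf_of_set P)) \<alpha>"
proof -
  have "v \<noteq> {}" "v \<subseteq> arcs G" using uv v P(2) by auto
  then obtain e where e: "e \<in> v" by blast
  \<comment> \<open>All interceptors on \<open>u\<close> go to the single arc \<open>e\<close> of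
    \<open>v\<close>. By disjointness no third path changes cost, and the costs of \<open>u\<close>
    and \<open>v\<close> keep their sum.\<close>
  define d' where "d' = (\<lambda>j\<in>{..<k}. if d j \<in> u then e else d j)"
  have d': "d' \<in> {..<k} \<rightarrow>\<^sub>E arcs G"
    using d e \<open>v \<subseteq> arcs G\<close> by (auto simp: d'_def PiE_iff)
  have disj: "x \<notin> q" if "x \<in> p" "p \<in> P" "q \<in> P" "p \<noteq> q" for x p q
    using P(3) that by (auto simp: disjoint_def)
  let ?w = "path_cost k d \<alpha>" and ?w' = "path_cost k d' \<alpha>"
  have "u \<noteq> v" using uv by auto
  have same: "?w' p = ?w p" if "p \<in> P" "p \<noteq> u" "p \<noteq> v" for p
  proof -
    have "(d' j \<in> p) = (d j \<in> p)" if "j < k" for j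
      using that \<open>p \<in> P\<close> \<open>p \<noteq> u\<close> \<open>p \<noteq> v\<close> disj[of e v p] disj[of "d j" u p] e u v
      by (auto simp: d'_def)
    then show ?thesis by (auto simp: path_cost_def intro!: sum.cong)
  qed
  have u': "?w' u = card u"
  proof -
    have "d' j \<notin> u" if "j < k" for j
      using that disj[OF e v u] \<open>u \<noteq> v\<close> by (auto simp: d'_def)
    then show ?thesis by (simp add: path_cost_def)
  qed
  have v': "?w' v = card v + \<alpha> * (\<Sum>j<k. of_bool (d j \<in> u) + of_bool (d j \<in> v))"
  proof -
    have "of_bool (d' j \<in> v) = (of_bool (d j \<in> u) + of_bool (d j \<in> v) :: real)" if "j < k" for j
      using that e disj[of "d j" u v] u v \<open>u \<noteq> v\<close> by (auto simp: d'_def)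
    then show ?thesis by (simp add: path_cost_def)
  qed
  have total: "?w' u + ?w' v = ?w u + ?w v"
    unfolding u' v' by (simp add: path_cost_def sum.distrib algebra_simps)
  have "(\<Sum>j<k. of_bool (d j \<in> u) :: real) > 0"
    using j by (intro sum_pos2[of _ j]) auto
  then have below_u: "?w' u < ?w u"
    unfolding u' using \<alpha> by (simp add: path_cost_def)
  \<comment> \<open>Freed of interceptors, \<open>u\<close> costs just its length, which is below
    the length of \<open>v\<close>; here the strict inequality \<open>uv\<close> enters.\<close>
  have below_v: "?w' u < ?w v"
  proof -
    have "real (card v) \<le> ?w v"
      unfolding path_cost_def using \<alpha> by (auto intro!: mult_nonneg_nonneg sum_nonneg)
    then show ?thesis using uv u' by linarith
  qed
  have "P \<noteq> {}" using u by auto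
  have pos: "real (card P) ^ n > 0" using \<open>P \<noteq> {}\<close> P by (simp add: card_gt_0_iff)
  have "uniform_cost d < uniform_cost d'"
    unfolding expectation_product_dist_uniform[OF P(1) \<open>P \<noteq> {}\<close>] max_cost_eq
    using sum_Max_spread[OF P(1) u v \<open>u \<noteq> v\<close> n same total below_u below_v] pos
    by (intro divide_strict_right_mono) auto
  also have "\<dots> \<le> worst_cost G n k (product_dist n (\<lambda>_. pmf_of_set P)) \<alpha>"
    using G(1) d' by (rule expectation_le_worst_cost)
  finally show ?thesis .
qed

text \<open>A shortest path without interceptors is a cheapest one, so moving agent 0 there raises
  the cost of no profile and lowers it for at least one.\<close>

lemma deviation_to_unintercepted_path:
  assumes u: "u \<in> P" and v: "v \<in> P" and uv: "card u < card v"
    and shortest: "\<And>p. p \<in> P \<Longrightarrow> card u \<le> card p" and d: "\<And>j. j < k \<Longrightarrow> d j \<notin> u"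
  shows "measure_pmf.expectation (product_dist n (\<lambda>_. pmf_of_set P))
      (\<lambda>a. max_cost n k (a(0 := u)) d \<alpha>) < uniform_cost d"
proof -
  have "P \<noteq> {}" using u by auto
  let ?A = "{..<n} \<rightarrow>\<^sub>E P"
  have cost_u: "path_cost k d \<alpha> u = card u" using d by (simp add: path_cost_def)
  have cost_ge: "real (card p) \<le> path_cost k d \<alpha> p" for p
    unfolding path_cost_def using \<alpha> by (auto intro!: mult_nonneg_nonneg sum_nonneg)
  have cheap: "path_cost k d \<alpha> u \<le> path_cost k d \<alpha> p" if "p \<in> P" for p
    using cost_u cost_ge[of p] shortest[OF that] by linarith
  \<comment> \<open>The strict gain: agent 0 alone is on \<open>v\<close> and all others on
    \<open>u\<close>, so the deviation brings the maximum from at least \<open>card v\<close> down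
    to at most \<open>card u\<close>.\<close>
  define b where "b = (\<lambda>i\<in>{..<n}. if i = 0 then v else u)"
  have b: "b \<in> ?A" using u v by (auto simp: b_def)
  have "max_cost n k (b(0 := u)) d \<alpha> \<le> card u"
    using n cost_u by (intro max_cost_leI) (auto simp: b_def)
  also have "\<dots> < path_cost k d \<alpha> (b 0)"
    using uv cost_ge[of v] n by (simp add: b_def)
  also have "\<dots> \<le> max_cost n k b d \<alpha>" using n by (intro path_cost_le_max_cost) auto
  finally have less: "max_cost n k (b(0 := u)) d \<alpha> < max_cost n k b d \<alpha>" .
  have "(\<Sum>a\<in>?A. max_cost n k (a(0 := u)) d \<alpha>) < (\<Sum>a\<in>?A. max_cost n k a d \<alpha>)"
    using P n less b cheap
    by (intro sum_strict_mono_ex1) (auto intro!: finite_PiE max_cost_cheapest_deviation[of _ _ P])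
  moreover have "real (card P) ^ n > 0" using \<open>P \<noteq> {}\<close> P by (simp add: card_gt_0_iff)
  ultimately show ?thesis
    unfolding expectation_product_dist_uniform[OF P(1) \<open>P \<noteq> {}\<close>]
    by (intro divide_strict_right_mono) auto
qed

text \<open>Interceptions attaining the worst cost avoid \<open>u\<close>, and against those the
  deviation to \<open>u\<close> strictly helps; \<open>mixture_below_Max\<close> then makes a small
  dose of it safe against all others as well.\<close>

lemma uniform_improvable:
  assumes u: "u \<in> P" and v: "v \<in> P" and uv: "card u < card v"
    and shortest: "\<And>p. p \<in> P \<Longrightarrow> card u \<le> card p"
  shows "\<exists>\<sigma>\<in>{..<n} \<rightarrow>\<^sub>E mixed P. worst_cost G n k (product_dist n \<sigma>) \<alpha> <
    worst_cost G n k (product_dist n (\<lambda>_. pmf_of_set P)) \<alpha>"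
proof -
  let ?F = "worst_cost G n k (product_dist n (\<lambda>_. pmf_of_set P)) \<alpha>"
  let ?D = "{..<k} \<rightarrow>\<^sub>E arcs G"
  let ?B = "\<lambda>d. measure_pmf.expectation (product_dist n (\<lambda>_. pmf_of_set P))
      (\<lambda>a. max_cost n k (a(0 := u)) d \<alpha>)"
  have "P \<noteq> {}" using u by auto
  have "?B d < ?F" if "d \<in> ?D" "uniform_cost d = ?F" for d
  proof -
    have "d j \<notin> u" if "j < k" for j
      using shorter_path_not_intercepted[OF u v uv \<open>d \<in> ?D\<close> that] \<open>uniform_cost d = ?F\<close> by auto
    then show ?thesis using deviation_to_unintercepted_path[OF u v uv shortest] that by metis
  qed
  then have "\<exists>\<epsilon>. 0 < \<epsilon> \<and> \<epsilon> < 1 \<and> (\<forall>d\<in>?D. \<epsilon> * ?B d + (1 - \<epsilon>) * uniform_cost d < ?F)"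
    by (intro mixture_below_Max finite_interceptions[OF G] expectation_le_worst_cost[OF G(1)])
  then obtain \<epsilon> where \<epsilon>: "0 < \<epsilon>" "\<epsilon> < 1"
    and less: "\<And>d. d \<in> ?D \<Longrightarrow> \<epsilon> * ?B d + (1 - \<epsilon>) * uniform_cost d < ?F"
    by metis
  define \<nu> where "\<nu> = bernoulli_pmf \<epsilon> \<bind> (\<lambda>b. if b then return_pmf u else pmf_of_set P)"
  \<comment> \<open>Restricting gives membership in the extensional strategy space and leaves the
    distribution unchanged, as \<open>product_dist\<close> reads only indices below
    \<open>n\<close>.\<close>
  define \<sigma> where "\<sigma> = restrict ((\<lambda>_. pmf_of_set P)(0 := \<nu>)) {..<n}"
  have \<sigma>_eq: "product_dist n \<sigma> = product_dist n ((\<lambda>_. pmf_of_set P)(0 := \<nu>))"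
    unfolding product_dist_def \<sigma>_def by (intro Pi_pmf_cong) auto
  have "measure_pmf.expectation (product_dist n \<sigma>) (\<lambda>a. max_cost n k a d \<alpha>) =
      \<epsilon> * ?B d + (1 - \<epsilon>) * uniform_cost d" for d
    unfolding \<sigma>_eq \<nu>_def using \<epsilon> n P \<open>P \<noteq> {}\<close> by (intro expectation_product_dist_mixture) auto
  then have "worst_cost G n k (product_dist n \<sigma>) \<alpha> < ?F"
    unfolding worst_cost_def[of _ _ _ "product_dist n \<sigma>"] using finite_interceptions[OF G] less
    by (subst Max_less_iff) auto
  moreover have "pmf_of_set P \<in> mixed P" "\<nu> \<in> mixed P"
    using u by (auto simp: mixed_def \<nu>_def set_pmf_of_set[OF \<open>P \<noteq> {}\<close> P(1)] split: if_splits)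
  then have "\<sigma> \<in> {..<n} \<rightarrow>\<^sub>E mixed P" by (auto simp: \<sigma>_def)
  ultimately show ?thesis by blast
qed

text \<open>All interceptors sit on one arc of \<open>u\<close>. Every profile costs at least
  \<open>card u\<close>, and at least \<open>k * \<alpha>\<close> more if some agent picks
  \<open>u\<close>, an event of probability \<open>1 - (1 - 1 / card P) ^ n\<close>.\<close>

lemma uniform_cost_single_path:
  assumes u: "u \<in> P" "u \<noteq> {}" and shortest: "\<And>p. p \<in> P \<Longrightarrow> card u \<le> card p"
  shows "real (card u) + (1 - (1 - 1 / real (card P)) ^ n) * real k * \<alpha>
    \<le> worst_cost G n k (product_dist n (\<lambda>_. pmf_of_set P)) \<alpha>"
proof -
  obtain e where e: "e \<in> u" using u by blast
  define d where "d = (\<lambda>j\<in>{..<k}. e)"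
  have d: "d \<in> {..<k} \<rightarrow>\<^sub>E arcs G" using e u P by (auto simp: d_def)
  let ?A = "{..<n} \<rightarrow>\<^sub>E P" and ?N = "{..<n} \<rightarrow>\<^sub>E (P - {u})"
  let ?l = "real (card P)"
  have "P \<noteq> {}" using u by auto
  then have l: "?l > 0" using P by (simp add: card_gt_0_iff)
  have fin: "finite ?A" using P by (auto intro!: finite_PiE)
  have cost_u: "path_cost k d \<alpha> u = card u + \<alpha> * k" using e by (simp add: path_cost_def d_def)
  have cost_ge: "real (card p) \<le> path_cost k d \<alpha> p" for p
    unfolding path_cost_def using \<alpha> by (auto intro!: mult_nonneg_nonneg sum_nonneg)
  have ge: "real (card u) + \<alpha> * k * of_bool (a \<notin> ?N) \<le> max_cost n k a d \<alpha>" if a: "a \<in> ?A" for a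
  proof (cases "a \<in> ?N")
    case True
    have "a 0 \<in> P" using a n by auto
    then have "real (card u) \<le> path_cost k d \<alpha> (a 0)" using shortest cost_ge by (meson of_nat_le_iff order_trans)
    then show ?thesis using True path_cost_le_max_cost[of 0 n k d \<alpha> a] n by simp
  next
    case False
    then obtain i where "i < n" "a i = u" using a by (auto simp: PiE_def Pi_def)
    then show ?thesis using False path_cost_le_max_cost[of i n k d \<alpha> a] cost_u by simp
  qed
  \<comment> \<open>Count by complement: \<open>?N\<close> consists of the profiles in which nobody
    picks \<open>u\<close>.\<close>
  have "(\<Sum>a\<in>?A. of_bool (a \<notin> ?N) :: real) = (\<Sum>a\<in>?A. 1) - (\<Sum>a\<in>?A. of_bool (a \<in> ?N))"
    unfolding sum_subtractf[symmetric] by (intro sum.cong) auto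
  also have "(\<Sum>a\<in>?A. of_bool (a \<in> ?N) :: real) = card (?A \<inter> ?N)"
    using fin by (simp add: Int_def)
  also have "?A \<inter> ?N = ?N" by auto
  finally have count: "(\<Sum>a\<in>?A. of_bool (a \<notin> ?N) :: real) = ?l ^ n - (?l - 1) ^ n"
    using u P l by (simp add: card_PiE of_nat_diff card_gt_0_iff Suc_leI)
  \<comment> \<open>The probability that no agent picks \<open>u\<close>.\<close>
  define q where "q = (1 - 1 / ?l) ^ n"
  have q: "(?l - 1) ^ n = ?l ^ n * q"
    unfolding q_def power_mult_distrib[symmetric] using l by (simp add: algebra_simps)
  have "(\<Sum>a\<in>?A. real (card u) + \<alpha> * k * of_bool (a \<notin> ?N)) = ?l ^ n * card u + \<alpha> * k * (?l ^ n - (?l - 1) ^ n)"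
    unfolding sum.distrib sum_distrib_left[symmetric] count by (simp add: card_PiE)
  also have "\<dots> = (card u + (1 - q) * k * \<alpha>) * ?l ^ n"
    unfolding q by algebra
  finally have "real (card u) + (1 - (1 - 1 / ?l) ^ n) * k * \<alpha> =
      (\<Sum>a\<in>?A. real (card u) + \<alpha> * k * of_bool (a \<notin> ?N)) / ?l ^ n"
    unfolding q_def[symmetric] using l by simp
  also have "\<dots> \<le> uniform_cost d"
    unfolding expectation_product_dist_uniform[OF P(1) \<open>P \<noteq> {}\<close>]
    using ge by (intro divide_right_mono sum_mono) auto
  also have "\<dots> \<le> worst_cost G n k (product_dist n (\<lambda>_. pmf_of_set P)) \<alpha>"
    using G(1) d by (rule expectation_le_worst_cost)
  finally show ?thesis .
qed

end

section \<open>The minimum as a function of the available paths\<close>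

lemma min_worst_cost_le:
  assumes "finite (arcs G)" "arcs G \<noteq> {}" "finite Q" "\<sigma> \<in> {..<n} \<rightarrow>\<^sub>E mixed Q" "Q \<noteq> {}"
  shows "min_worst_cost G n k Q \<alpha> \<le> worst_cost G n k (product_dist n \<sigma>) \<alpha>"
  using min_worst_cost_attained[OF assms(1,2,3,5), of n k \<alpha>] assms(4) by metis

lemma mixed_mono: "Q \<subseteq> Q' \<Longrightarrow> mixed Q \<subseteq> mixed Q'"
  by (auto simp: mixed_def)

lemma min_worst_cost_antimono:
  assumes "finite (arcs G)" "arcs G \<noteq> {}" "finite Q'" "Q \<subseteq> Q'" "Q \<noteq> {}"
  shows "min_worst_cost G n k Q' \<alpha> \<le> min_worst_cost G n k Q \<alpha>"
proof -
  obtain \<sigma> where "\<sigma> \<in> {..<n} \<rightarrow>\<^sub>E mixed Q"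
    "worst_cost G n k (product_dist n \<sigma>) \<alpha> = min_worst_cost G n k Q \<alpha>"
    using min_worst_cost_attained[of G Q n k \<alpha>] assms finite_subset by blast
  moreover from this have "\<sigma> \<in> {..<n} \<rightarrow>\<^sub>E mixed Q'"
    using PiE_mono[of "{..<n}" "\<lambda>_. mixed Q"] mixed_mono[OF assms(4)] by blast
  ultimately show ?thesis
    using min_worst_cost_le[of G Q' \<sigma> n k \<alpha>] assms by auto
qed

text \<open>A walk between distinct vertices has an arc; this supplies the arc on which
  \<open>uniform_cost_single_path\<close> places the interceptors.\<close>

lemma (in st_graph) st_path_nonempty: "p \<in> st_paths G s t \<Longrightarrow> p \<noteq> {}"
  using source_neq_sink by (auto simp: st_paths_def apath_def awalk_def)

lemma (in st_graph) st_path_subset: "p \<in> st_paths G s t \<Longrightarrow> p \<subseteq> arcs G"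
  by (auto simp: st_paths_def apath_def awalk_def)

section \<open>Comparison with every uniform strategy\<close>

theorem theorem11:
  fixes G :: "('a, 'b) pre_digraph" and s t :: 'a
    and n k :: nat and \<alpha> :: real and p_max p_min :: "'b set"
  assumes G: "st_graph G s t"
    and n: "n > 1" and k: "k \<ge> 1"
    and p_max: "is_arg_max card (\<lambda>p. p \<in> st_paths G s t) p_max"
    and p_min: "is_arg_min card (\<lambda>p. p \<in> st_paths G s t) p_min"
    and \<alpha>: "\<alpha> > (real (card p_max) - real (card p_min)) / real k"
    and lengths: "\<And>Q ps. Q \<in> MF G s t \<Longrightarrow> ps \<in> orderings Q \<Longrightarrow> card (hd ps) < card (last ps)"
    and \<alpha>_large: "\<And>Q ps. Q \<in> MF G s t \<Longrightarrow> ps \<in> orderings Q \<Longrightarrow>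
      min_worst_cost G n k Q \<alpha> <
        real (card (hd ps)) + hit_factor (num_shortest ps) n / real (num_shortest ps) * real k * \<alpha>"
  shows "min_worst_cost G n k (st_paths G s t) \<alpha> <
    (MIN \<sigma>\<in>uniform_strategies G s t n. worst_cost G n k \<sigma> \<alpha>)"
proof -
  interpret st_graph G s t by (rule G)
  have arcs: "finite (arcs G)" "arcs G \<noteq> {}" using arcs_nonempty by auto
  \<comment> \<open>The lower bound on \<alpha> is nonnegative, which makes \<alpha>
    positive.\<close>
  have "card p_min \<le> card p_max"
    using p_max p_min by (auto simp: is_arg_max_def is_arg_min_def not_less)
  then have "(real (card p_max) - real (card p_min)) / real k \<ge> 0" by simp
  then have \<alpha>0: "\<alpha> > 0" using \<alpha> by linarith
  let ?U = "\<lambda>P. product_dist n (\<lambda>_. pmf_of_set P)"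
  have main: "min_worst_cost G n k (st_paths G s t) \<alpha> < worst_cost G n k (?U P) \<alpha>"
    if prefix: "P \<in> prefixes_MF G s t" for P
  proof -
    obtain Q ps i where Q: "Q \<in> MF G s t" and ps: "ps \<in> orderings Q"
      and i: "1 \<le> i" "i \<le> length ps" and P: "P = set (take i ps)"
      using prefix by (auto simp: prefixes_MF_def)
    have dist: "distinct ps" and setps: "set ps = Q" and sorted: "sorted (map card ps)"
      using ps by (auto simp: orderings_def)
    have Q_st: "Q \<subseteq> st_paths G s t" and "disjoint Q"
      using Q by (auto simp: MF_def edge_disjoint_sets_def)
    have PQ: "P \<subseteq> Q" unfolding P setps[symmetric] by (rule set_take_subset)
    have "ps \<noteq> []" using i by auto
    then have hd: "hd ps = ps ! 0" by (rule hd_conv_nth)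
    have mono: "card (ps ! x) \<le> card (ps ! y)" if "x \<le> y" "y < length ps" for x y
      using sorted_nth_mono[OF sorted that(1)] that by simp
    have nth_P: "ps ! x \<in> P" if "x < i" for x
      using that i by (force simp: P in_set_conv_nth)
    have P_nth: "\<exists>x<i. p = ps ! x" if "p \<in> P" for p
      using that i by (force simp: P in_set_conv_nth)
    have finP: "finite P" by (simp add: P)
    have subP: "\<Union>P \<subseteq> arcs G" using PQ Q_st st_path_subset by blast
    have disjP: "disjoint P" using \<open>disjoint Q\<close> PQ by (auto simp: disjoint_def)
    have hdP: "hd ps \<in> P" unfolding hd using i by (intro nth_P) auto
    have shortest: "card (hd ps) \<le> card p" if "p \<in> P" for p
      using P_nth[OF that] mono i hd by auto
    show ?thesis
    proof (cases "\<exists>v\<in>P. card (hd ps) < card v")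
      case True
      \<comment> \<open>Uniform play on \<open>P\<close> is improvable within \<open>P\<close>, and
        passing from \<open>P\<close> to all paths can only lower the minimum.\<close>
      then obtain v where v: "v \<in> P" "card (hd ps) < card v" by blast
      obtain \<sigma> where \<sigma>: "\<sigma> \<in> {..<n} \<rightarrow>\<^sub>E mixed P"
        "worst_cost G n k (product_dist n \<sigma>) \<alpha> < worst_cost G n k (?U P) \<alpha>"
        using uniform_improvable[OF arcs finP subP disjP n \<alpha>0 hdP v shortest, of k] by auto
      have "min_worst_cost G n k (st_paths G s t) \<alpha> \<le> min_worst_cost G n k P \<alpha>"
        using PQ Q_st hdP by (intro min_worst_cost_antimono arcs finite_st_paths) auto
      also have "\<dots> \<le> worst_cost G n k (product_dist n \<sigma>) \<alpha>"
        using hdP by (intro min_worst_cost_le arcs finP \<sigma>) auto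
      finally show ?thesis using \<sigma>(2) by linarith
    next
      case False
      let ?m = "num_shortest ps"
      have all: "card (ps ! x) = card (ps ! 0)" if "x < i" for x
        using False nth_P[OF that] shortest hd by (metis le_neq_implies_less)
      \<comment> \<open>The first \<open>i\<close> paths have equal length, so \<open>i\<close>
        competes in the maximum defining \<open>?m\<close>; \<open>length ps\<close> bounds all
        competitors.\<close>
      have "i \<le> ?m" unfolding num_shortest_def
        using all i by (intro Greatest_le_nat[where b = "length ps"]) blast+
      then have "?m > 0" using i by linarith
      have cardP: "card P = i"
        unfolding P using dist i by (simp add: distinct_card)
      \<comment> \<open>The chance that some agent picks a given path falls as the number of paths
        grows. Hence the bound of \<open>\<alpha>_large\<close>, stated for \<open>?m\<close> paths,
        is at most the one for the \<open>i\<close> paths of \<open>P\<close>.\<close>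
      have "1 / real ?m \<le> 1 / real i"
        using \<open>i \<le> ?m\<close> i by (intro divide_left_mono) auto
      then have "(1 - 1 / real i) ^ n \<le> (1 - 1 / real ?m) ^ n"
        using i by (intro power_mono) auto
      then have "(1 - (1 - 1 / real ?m) ^ n) * (real k * \<alpha>) \<le> (1 - (1 - 1 / real i) ^ n) * (real k * \<alpha>)"
        using \<alpha>0 by (intro mult_right_mono) auto
      moreover have "hit_factor ?m n / real ?m = 1 - (1 - 1 / real ?m) ^ n"
        using \<open>?m > 0\<close> by (simp add: hit_factor_def)
      ultimately have "min_worst_cost G n k Q \<alpha> <
          real (card (hd ps)) + (1 - (1 - 1 / real (card P)) ^ n) * real k * \<alpha>"
        using \<alpha>_large[OF Q ps] by (simp add: cardP mult.assoc)
      also have "\<dots> \<le> worst_cost G n k (?U P) \<alpha>"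
        using hdP PQ Q_st st_path_nonempty shortest
        by (intro uniform_cost_single_path[OF arcs finP subP disjP n \<alpha>0]) auto
      finally have "min_worst_cost G n k Q \<alpha> < worst_cost G n k (?U P) \<alpha>" .
      moreover have "min_worst_cost G n k (st_paths G s t) \<alpha> \<le> min_worst_cost G n k Q \<alpha>"
        using Q_st hdP PQ by (intro min_worst_cost_antimono arcs finite_st_paths) auto
      ultimately show ?thesis by linarith
    qed
  qed
  show ?thesis
    using finite_uniform_strategies uniform_strategies_nonempty main
    by (subst Min_gr_iff) (auto simp: uniform_strategies_def)
qed

end
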